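(* Let $T$ be a propositional theory over $\mathcal V$, let $(\mathcal A,\oplus,\otimes,e^\oplus,e^\otimes)$ be a commutative semiring, and let $\alpha:\mathcal L\to\mathcal A$ be a labeling function on the literals of $\mathcal V$. Assume that $\oplus$ is idempotent ($a\oplus a=a$ for all $a\in\mathcal A$) and that $(\oplus,\alpha)$ is neutral, i.e. $\alpha(v)\oplus\alpha(\neg v)=e^\otimes$ for all $v\in\mathcal V$. If $N_T$ is a DNNF representation of $T$ (i.e. an NNF circuit over $\mathcal V$ that is decomposable and is logically equivalent to $T$), then evaluating $N_T$ is a sound AMC computation, i.e. $$\mathrm{Eval}(N_T,\oplus,\otimes,e^\oplus,e^\otimes,\alpha)=\mathbf A(T).$$
   Context: A semiring $(\mathcal A,\oplus,\otimes,e^\oplus,e^\otimes)$ has associative binary operations $\oplus,\otimes$ on $\mathcal A$, with $\oplus$ commutative, $\otimes$ distributing over $\oplus$, $e^\oplus$ neutral for $\oplus$, $e^\otimes$ neutral for $\otimes$, and $e^\oplus\otimes a=a\otimes e^\oplus=e^\oplus$ for all $a$. It is commutative if $\otimes$ is also commutative. Algebraic model count: for a propositional theory $T$ over a finite set $\mathcal V$ of variables and $\alpha:\mathcal L\to\mathcal A$ on the set $\mathcal L$ of literals of $\mathcal V$, $$\mathbf A(T)=\bigoplus_{I\in\mathcal M(T)}\ \bigotimes_{l\in I}\alpha(l),$$ where $\mathcal M(T)$ is the set of models of $T$; a model is a set of literals containing exactly one of $v,\neg v$ for each $v\in\mathcal V$. Empty sums are $e^\oplus$, empty products $e^\otimes$.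 An NNF circuit over $\mathcal V$ is a finite rooted directed acyclic graph whose leaves are labeled with $\top$, $\bot$ or a literal of a variable in $\mathcal V$, and whose internal nodes are labeled $\vee$ or $\wedge$. Each node is identified with the formula of the subcircuit rooted at it, and its variables are those occurring in that subcircuit. The circuit is decomposable if for each conjunction node $\bigwedge_{i=1}^n\phi_i$ no two children $\phi_i,\phi_j$ ($i\ne j$) share a variable. $\mathrm{Eval}$ is defined recursively from the leaves to the root: $\top\mapsto e^\otimes$, $\bot\mapsto e^\oplus$, literal $l\mapsto\alpha(l)$, a disjunction node $\mapsto$ the $\oplus$-sum of the values of its children, a conjunction node $\mapsto$ the $\otimes$-product of the values of its children; the value of the circuit is that of its root. *)

theory Defs
  imports Main "HOL-Library.FSet"
begin

section \<open>Propositional theories and algebraic model counting\<close>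

datatype 'v literal = Pos 'v | Neg 'v

definition literals :: "'v set \<Rightarrow> 'v literal set" where
  "literals V = Pos ` V \<union> Neg ` V"

datatype (vars: 'v) formula =
    Verum
  | Falsum
  | Var 'v
  | Negation "'v formula"
  | Conj "'v formula fset"
  | Disj "'v formula fset"

fun formula_of_literal :: "'v literal \<Rightarrow> 'v formula" where
  "formula_of_literal (Pos v) = Var v"
| "formula_of_literal (Neg v) = Negation (Var v)"

lemma size_less_sum_fset:
  fixes p :: "'v formula"
  assumes "p |\<in>| F"
  shows "size p < Suc (\<Sum>x\<in>fset F. Suc (size x))"
  using member_le_sum[of p "fset F" "\<lambda>x. Suc (size x)"] assms by simp

function satisfies :: "'v literal set \<Rightarrow> 'v formula \<Rightarrow> bool" where
  "satisfies I Verum \<longleftrightarrow> True"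
| "satisfies I Falsum \<longleftrightarrow> False"
| "satisfies I (Var v) \<longleftrightarrow> Pos v \<in> I"
| "satisfies I (Negation p) \<longleftrightarrow> \<not> satisfies I p"
| "satisfies I (Conj F) \<longleftrightarrow> (\<forall>p \<in> fset F. satisfies I p)"
| "satisfies I (Disj F) \<longleftrightarrow> (\<exists>p \<in> fset F. satisfies I p)"
  by pat_completeness auto
termination
  by (relation "measure (size \<circ> snd)") (auto simp: size_less_sum_fset)

definition interpretations :: "'v set \<Rightarrow> 'v literal set set" where
  "interpretations V = {I. I \<subseteq> literals V \<and> (\<forall>v\<in>V. (Pos v \<in> I) \<noteq> (Neg v \<in> I))}"

text \<open>A theory is a set of formulas, read conjunctively.\<close>

definition theory_over :: "'v set \<Rightarrow> 'v formula set \<Rightarrow> bool" where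
  "theory_over V T \<longleftrightarrow> (\<forall>p\<in>T. vars p \<subseteq> V)"

definition models :: "'v set \<Rightarrow> 'v formula set \<Rightarrow> 'v literal set set" where
  "models V T = {I \<in> interpretations V. \<forall>p\<in>T. satisfies I p}"

definition logically_equivalent :: "'v set \<Rightarrow> 'v formula set \<Rightarrow> 'v formula set \<Rightarrow> bool" where
  "logically_equivalent V S T \<longleftrightarrow> models V S = models V T"

text \<open>
  The sort \<open>{comm_semiring_0, comm_monoid_mult}\<close> is that of commutative semirings with
  zero and one; unlike \<open>comm_semiring_1\<close> it does not require zero and one to be distinct.
\<close>

definition amc ::
  "'v set \<Rightarrow> 'v formula set \<Rightarrow> ('v literal \<Rightarrow> 'a::{comm_semiring_0,comm_monoid_mult}) \<Rightarrow> 'a" where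
  "amc V T \<alpha> = (\<Sum>I\<in>models V T. \<Prod>l\<in>I. \<alpha> l)"


section \<open>NNF circuits\<close>

datatype 'v node_label = Top | Bot | Lit "'v literal" | And | Or

record ('n, 'v) circuit =
  nodes :: "'n set"
  edges :: "('n \<times> 'n) set"  \<comment> \<open>directed from parent to child\<close>
  label :: "'n \<Rightarrow> 'v node_label"
  root :: 'n

definition children :: "('n, 'v) circuit \<Rightarrow> 'n \<Rightarrow> 'n set" where
  "children N n = {m. (n, m) \<in> edges N}"

locale nnf_circuit =
  fixes V :: "'v set" and N :: "('n, 'v) circuit"
  assumes finite_nodes: "finite (nodes N)"
    and edges_subset: "edges N \<subseteq> nodes N \<times> nodes N"
    and acyclic_edges: "acyclic (edges N)"
    and root_in_nodes: "root N \<in> nodes N"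
    and reachable: "\<And>n. n \<in> nodes N \<Longrightarrow> (root N, n) \<in> (edges N)\<^sup>*"
    and internal_iff: "\<And>n. n \<in> nodes N \<Longrightarrow> children N n \<noteq> {} \<longleftrightarrow> label N n \<in> {And, Or}"
    and literals_over: "\<And>n l. n \<in> nodes N \<Longrightarrow> label N n = Lit l \<Longrightarrow> l \<in> literals V"
begin

lemma finite_edges: "finite (edges N)"
  using finite_nodes edges_subset by (meson finite_SigmaI finite_subset)

lemma wf_edges: "wf ((edges N)\<inverse>)"
  using finite_edges acyclic_edges by (rule finite_acyclic_wf_converse)

lemma finite_children: "finite (children N n)"
  by (rule finite_subset[OF _ finite_nodes]) (use edges_subset in \<open>auto simp: children_def\<close>)

text \<open>\<open>Abs_fset\<close> is only applied to finite sets here (lemma \<open>finite_children\<close>).\<close>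

function formula_of_node :: "'n \<Rightarrow> 'v formula" where
  "formula_of_node n =
    (case label N n of
       Top \<Rightarrow> Verum
     | Bot \<Rightarrow> Falsum
     | Lit l \<Rightarrow> formula_of_literal l
     | And \<Rightarrow> Conj (Abs_fset (formula_of_node ` children N n))
     | Or \<Rightarrow> Disj (Abs_fset (formula_of_node ` children N n)))"
  by pat_completeness auto
termination
  by (relation "(edges N)\<inverse>") (auto simp: wf_edges children_def)

declare formula_of_node.simps [simp del]

definition decomposable :: bool where
  "decomposable \<longleftrightarrow>
    (\<forall>n\<in>nodes N. label N n = And \<longrightarrow>
      (\<forall>m\<in>children N n. \<forall>m'\<in>children N n. m \<noteq> m' \<longrightarrow>
        vars (formula_of_node m) \<inter> vars (formula_of_node m') = {}))"

function eval_node ::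
  "('v literal \<Rightarrow> 'a::{comm_semiring_0,comm_monoid_mult}) \<Rightarrow> 'n \<Rightarrow> 'a" where
  "eval_node \<alpha> n =
    (case label N n of
       Top \<Rightarrow> 1
     | Bot \<Rightarrow> 0
     | Lit l \<Rightarrow> \<alpha> l
     | And \<Rightarrow> (\<Prod>m\<in>children N n. eval_node \<alpha> m)
     | Or \<Rightarrow> (\<Sum>m\<in>children N n. eval_node \<alpha> m))"
  by pat_completeness auto
termination
  by (relation "inv_image ((edges N)\<inverse>) snd") (auto simp: wf_edges children_def)

declare eval_node.simps [simp del]

definition eval :: "('v literal \<Rightarrow> 'a::{comm_semiring_0,comm_monoid_mult}) \<Rightarrow> 'a" where
  "eval \<alpha> = eval_node \<alpha> (root N)"

end

definition dnnf_representation ::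
  "'v set \<Rightarrow> ('n, 'v) circuit \<Rightarrow> 'v formula set \<Rightarrow> bool" where
  "dnnf_representation V N T \<longleftrightarrow>
    nnf_circuit V N \<and> nnf_circuit.decomposable N \<and>
    logically_equivalent V {nnf_circuit.formula_of_node N (root N)} T"

end

theory Submission
  imports Defs "HOL-Library.FuncSet"
begin

text \<open>
  By neutrality, summing the weights of all interpretations gives one, so the model count of a
  theory does not change when variables that do not occur in it are added.  Hence theories without
  common variables have multiplicative counts, which handles decomposable conjunctions.
  Idempotence makes the count additive over disjunctions whose disjuncts need not exclude one
  another.  Both rules follow \<open>Eval\<close> from the leaves to the root.
\<close>

text \<open>\<open>satisfies\<close> tests membership of positive literals only, so \<open>I\<close>
  and \<open>J\<close> need not be interpretations and negative literals may differ.\<close>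

lemma satisfies_cong:
  assumes "\<And>v. v \<in> vars p \<Longrightarrow> Pos v \<in> I \<longleftrightarrow> Pos v \<in> J"
  shows "satisfies I p \<longleftrightarrow> satisfies J p"
  using assms
proof (induction p)
  case (Conj F)
  have "satisfies I p \<longleftrightarrow> satisfies J p" if "p \<in> fset F" for p
    using Conj that by auto
  then show ?case by simp
next
  case (Disj F)
  have "satisfies I p \<longleftrightarrow> satisfies J p" if "p \<in> fset F" for p
    using Disj that by auto
  then show ?case by simp
qed auto

section \<open>Interpretations over disjoint sets of variables\<close>

lemma literals_Un: "literals (V \<union> W) = literals V \<union> literals W"
  by (auto simp: literals_def)

lemma literals_disjoint: "V \<inter> W = {} \<Longrightarrow> literals V \<inter> literals W = {}"
  by (auto simp: literals_def)

lemma finite_literals: "finite V \<Longrightarrow> finite (literals V)"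
  by (simp add: literals_def)

lemma Pos_in_literals [simp]: "Pos v \<in> literals V \<longleftrightarrow> v \<in> V"
  and Neg_in_literals [simp]: "Neg v \<in> literals V \<longleftrightarrow> v \<in> V"
  by (auto simp: literals_def)

lemma interpretation_subset: "I \<in> interpretations V \<Longrightarrow> I \<subseteq> literals V"
  by (simp add: interpretations_def)

lemma finite_interpretation: "finite V \<Longrightarrow> I \<in> interpretations V \<Longrightarrow> finite I"
  using finite_literals finite_subset interpretation_subset by metis

lemma finite_interpretations: "finite V \<Longrightarrow> finite (interpretations V)"
  by (rule finite_subset[of _ "Pow (literals V)"])
    (auto simp: finite_literals dest: interpretation_subset)

lemma interpretations_empty: "interpretations {} = {{}}"
  by (auto simp: interpretations_def literals_def)

lemma interpretations_singleton: "interpretations {v} = {{Pos v}, {Neg v}}"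
  by (auto simp: interpretations_def literals_def)

lemma interpretations_restrict:
  assumes "I \<in> interpretations V" "W \<subseteq> V"
  shows "I \<inter> literals W \<in> interpretations W"
  using assms by (auto simp: interpretations_def)

text \<open>On a common variable the union could contain both literals; disjointness lets each
  variable be decided by exactly one of the two parts.\<close>

lemma interpretations_Un:
  assumes "I \<in> interpretations V" "J \<in> interpretations W" "V \<inter> W = {}"
  shows "I \<union> J \<in> interpretations (V \<union> W)"
proof -
  have "Pos v \<notin> J" "Neg v \<notin> J" if "v \<in> V" for v
    using that assms interpretation_subset[of J W] by force+
  moreover have "Pos v \<notin> I" "Neg v \<notin> I" if "v \<in> W" for v
    using that assms interpretation_subset[of I V] by force+
  ultimately show ?thesis
    using assms by (auto simp: interpretations_def literals_Un)
qed

text \<open>Intersecting with the literals of either side undoes the union. This turns a sum over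
  \<open>interpretations (V \<union> W)\<close> into a double sum.\<close>

lemma interpretations_Un_bij:
  assumes "V \<inter> W = {}"
  shows "bij_betw (\<lambda>(I, J). I \<union> J) (interpretations V \<times> interpretations W)
    (interpretations (V \<union> W))"
proof (rule bij_betwI[where g = "\<lambda>I. (I \<inter> literals V, I \<inter> literals W)"])
  show "(\<lambda>(I, J). I \<union> J) \<in> interpretations V \<times> interpretations W \<rightarrow> interpretations (V \<union> W)"
    using assms by (auto intro: interpretations_Un)
  show "(\<lambda>I. (I \<inter> literals V, I \<inter> literals W))
      \<in> interpretations (V \<union> W) \<rightarrow> interpretations V \<times> interpretations W"
    by (auto intro: interpretations_restrict[of _ "V \<union> W"])
  show "(\<lambda>I. (I \<inter> literals V, I \<inter> literals W)) ((\<lambda>(I, J). I \<union> J) X) = X"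
    if "X \<in> interpretations V \<times> interpretations W" for X
    using that literals_disjoint[OF assms]
    by (cases X) (auto dest!: interpretation_subset)
  show "(\<lambda>(I, J). I \<union> J) ((\<lambda>I. (I \<inter> literals V, I \<inter> literals W)) I) = I"
    if "I \<in> interpretations (V \<union> W)" for I
    using interpretation_subset[OF that] by (auto simp: literals_Un)
qed

section \<open>Algebraic model counts of theories\<close>

lemma theory_over_singleton [simp]: "theory_over V {p} \<longleftrightarrow> vars p \<subseteq> V"
  by (simp add: theory_over_def)

text \<open>Moving satisfaction into the summand makes the index set independent of the theory, so
  that sums for different theories can be multiplied out or swapped.\<close>

lemma amc_altdef:
  assumes "finite V"
  shows "amc V T \<alpha> =
    (\<Sum>I\<in>interpretations V. if \<forall>p\<in>T. satisfies I p then \<Prod>l\<in>I. \<alpha> l else 0)"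
  unfolding amc_def models_def
  using finite_interpretations[OF assms] by (rule sum.inter_filter)

text \<open>Each side constrains only its own part of an interpretation, and weights multiply over
  the two disjoint parts; distributivity then factors the double sum.\<close>

lemma amc_Un_disjoint:
  fixes \<alpha> :: "'v literal \<Rightarrow> 'a::{comm_semiring_0,comm_monoid_mult}"
  assumes fin: "finite V" "finite W" and disj: "V \<inter> W = {}"
    and S: "theory_over V S" and T: "theory_over W T"
  shows "amc (V \<union> W) (S \<union> T) \<alpha> = amc V S \<alpha> * amc W T \<alpha>"
proof -
  let ?w = "\<lambda>T I. if \<forall>p\<in>T. satisfies I p then \<Prod>l\<in>I. \<alpha> l else 0"
  have split: "?w (S \<union> T) (I \<union> J) = ?w S I * ?w T J"
    if I: "I \<in> interpretations V" and J: "J \<in> interpretations W" for I J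
  proof -
    \<comment> \<open>The literals of \<open>J\<close> are over \<open>W\<close>, hence invisible to
      formulas over \<open>V\<close>.\<close>
    have "satisfies (I \<union> J) p = satisfies I p" if "p \<in> S" for p
      by (rule satisfies_cong)
        (use that S disj interpretation_subset[OF J] in \<open>force simp: theory_over_def\<close>)
    moreover have "satisfies (I \<union> J) p = satisfies J p" if "p \<in> T" for p
      by (rule satisfies_cong)
        (use that T disj interpretation_subset[OF I] in \<open>force simp: theory_over_def\<close>)
    moreover have "I \<inter> J = {}"
      using literals_disjoint[OF disj] interpretation_subset[OF I] interpretation_subset[OF J]
      by blast
    then have "(\<Prod>l\<in>I \<union> J. \<alpha> l) = (\<Prod>l\<in>I. \<alpha> l) * (\<Prod>l\<in>J. \<alpha> l)"
      using finite_interpretation[OF fin(1) I] finite_interpretation[OF fin(2) J]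
      by (intro prod.union_disjoint)
    ultimately show ?thesis by (auto simp: ball_Un)
  qed
  have "amc (V \<union> W) (S \<union> T) \<alpha> =
      (\<Sum>(I, J)\<in>interpretations V \<times> interpretations W. ?w (S \<union> T) (I \<union> J))"
    unfolding amc_altdef[OF finite_UnI[OF fin]]
    by (subst sum.reindex_bij_betw[OF interpretations_Un_bij[OF disj], symmetric])
      (simp only: case_prod_unfold)
  also have "\<dots> = (\<Sum>(I, J)\<in>interpretations V \<times> interpretations W. ?w S I * ?w T J)"
    by (rule sum.cong[OF refl]) (clarify, rule split)
  also have "\<dots> = amc V S \<alpha> * amc W T \<alpha>"
    unfolding amc_altdef[OF fin(1)] amc_altdef[OF fin(2)] sum_product
    by (rule sum.cartesian_product[symmetric])
  finally show ?thesis .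
qed

text \<open>The sum is the expansion of the product of all
  \<open>\<alpha> (Pos v) + \<alpha> (Neg v)\<close>, each factor of which is one; the induction
  splits off one factor at a time.\<close>

lemma amc_empty_theory:
  fixes \<alpha> :: "'v literal \<Rightarrow> 'a::{comm_semiring_0,comm_monoid_mult}"
  assumes "finite V" and "\<And>v. v \<in> V \<Longrightarrow> \<alpha> (Pos v) + \<alpha> (Neg v) = 1"
  shows "amc V {} \<alpha> = 1"
  using assms
proof (induction V rule: finite_induct)
  case empty
  show ?case by (simp add: amc_def models_def interpretations_empty)
next
  case (insert v V)
  have "amc ({v} \<union> V) ({} \<union> {}) \<alpha> = amc {v} {} \<alpha> * amc V {} \<alpha>"
    using insert.hyps by (intro amc_Un_disjoint) (auto simp: theory_over_def)
  moreover have "amc {v} {} \<alpha> = 1"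
    using insert.prems by (simp add: amc_altdef interpretations_singleton)
  ultimately show ?case using insert by simp
qed

text \<open>This stands in for smoothness of the circuit: children that mention different variables
  can be counted over a common set.\<close>

lemma amc_add_variables:
  fixes \<alpha> :: "'v literal \<Rightarrow> 'a::{comm_semiring_0,comm_monoid_mult}"
  assumes "finite V" and "\<And>v. v \<in> V \<Longrightarrow> \<alpha> (Pos v) + \<alpha> (Neg v) = 1"
    and "W \<subseteq> V" "theory_over W T"
  shows "amc V T \<alpha> = amc W T \<alpha>"
proof -
  \<comment> \<open>The surplus variables carry the empty theory and contribute a factor
    one.\<close>
  have "amc (W \<union> (V - W)) (T \<union> {}) \<alpha> = amc W T \<alpha> * amc (V - W) {} \<alpha>"
    using assms by (intro amc_Un_disjoint) (auto simp: theory_over_def intro: finite_subset)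
  moreover have "amc (V - W) {} \<alpha> = 1"
    using assms by (intro amc_empty_theory) auto
  moreover have "W \<union> (V - W) = V" using \<open>W \<subseteq> V\<close> by blast
  ultimately show ?thesis by simp
qed

text \<open>All three counts are over the same \<open>V\<close>. Each is cut down to the variables
  occurring in its theory, where the product rule for disjoint variable sets applies.\<close>

lemma amc_Un:
  fixes \<alpha> :: "'v literal \<Rightarrow> 'a::{comm_semiring_0,comm_monoid_mult}"
  assumes fin: "finite V" and neutral: "\<And>v. v \<in> V \<Longrightarrow> \<alpha> (Pos v) + \<alpha> (Neg v) = 1"
    and over: "theory_over V S" "theory_over V T"
    and disj: "\<And>p q. p \<in> S \<Longrightarrow> q \<in> T \<Longrightarrow> vars p \<inter> vars q = {}"
  shows "amc V (S \<union> T) \<alpha> = amc V S \<alpha> * amc V T \<alpha>"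
proof -
  let ?S = "\<Union>p\<in>S. vars p" and ?T = "\<Union>p\<in>T. vars p"
  have sub: "?S \<subseteq> V" "?T \<subseteq> V" using over by (auto simp: theory_over_def)
  then have fin': "finite ?S" "finite ?T" using fin finite_subset by metis+
  have "?S \<inter> ?T = {}" using disj by blast
  then have "amc (?S \<union> ?T) (S \<union> T) \<alpha> = amc ?S S \<alpha> * amc ?T T \<alpha>"
    using fin' by (intro amc_Un_disjoint) (auto simp: theory_over_def)
  moreover have "amc V (S \<union> T) \<alpha> = amc (?S \<union> ?T) (S \<union> T) \<alpha>"
    using fin neutral sub by (intro amc_add_variables) (auto simp: theory_over_def)
  moreover have "amc V S \<alpha> = amc ?S S \<alpha>"
    using fin neutral sub by (intro amc_add_variables) (auto simp: theory_over_def)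
  moreover have "amc V T \<alpha> = amc ?T T \<alpha>"
    using fin neutral sub by (intro amc_add_variables) (auto simp: theory_over_def)
  ultimately show ?thesis by simp
qed

text \<open>Indices stand for nodes, and distinct nodes may carry the same formula: the image merges
  them while the product repeats the factor. Disjointness makes such a formula variable-free, and
  \<open>amc_Un\<close> still applies because it allows \<open>S\<close> and \<open>T\<close> to
  overlap.\<close>

lemma amc_image_prod:
  fixes \<alpha> :: "'v literal \<Rightarrow> 'a::{comm_semiring_0,comm_monoid_mult}"
  assumes fin: "finite V" and neutral: "\<And>v. v \<in> V \<Longrightarrow> \<alpha> (Pos v) + \<alpha> (Neg v) = 1"
    and "finite C" "\<And>c. c \<in> C \<Longrightarrow> vars (f c) \<subseteq> V"
    and "\<And>c d. c \<in> C \<Longrightarrow> d \<in> C \<Longrightarrow> c \<noteq> d \<Longrightarrow> vars (f c) \<inter> vars (f d) = {}"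
  shows "amc V (f ` C) \<alpha> = (\<Prod>c\<in>C. amc V {f c} \<alpha>)"
  using assms(3-)
proof (induction C rule: finite_induct)
  case empty
  show ?case using amc_empty_theory[of V \<alpha>] fin neutral by simp
next
  case (insert c C)
  have "vars (f c) \<inter> vars (f d) = {}" if "d \<in> C" for d
    using insert.hyps(2) insert.prems(2) that by (metis insertCI)
  then have "amc V ({f c} \<union> f ` C) \<alpha> = amc V {f c} \<alpha> * amc V (f ` C) \<alpha>"
    using fin neutral insert.prems(1) by (intro amc_Un) (auto simp: theory_over_def)
  then show ?case using insert by simp
qed

section \<open>Model counts of connectives and literals\<close>

lemma amc_Conj:
  assumes "finite C"
  shows "amc V {Conj (Abs_fset (f ` C))} \<alpha> = amc V (f ` C) \<alpha>"
  using assms by (simp add: amc_def models_def Abs_fset_inverse)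

text \<open>Here \<open>a\<close> will be the weight of one interpretation, counted once for each
  disjunct that it satisfies.\<close>

lemma sum_idempotent:
  fixes a :: "'a::comm_monoid_add"
  assumes "finite C" and "a + a = a"
  shows "(\<Sum>c\<in>C. if P c then a else 0) = (if \<exists>c\<in>C. P c then a else 0)"
  using assms(1) by (induction C rule: finite_induct) (auto simp: assms(2))

text \<open>After the sums over disjuncts and interpretations are swapped, idempotence collapses the
  repeated weight of each interpretation. This stands in for determinism and also absorbs equal
  formulas at distinct indices.\<close>

lemma amc_Disj:
  fixes \<alpha> :: "'v literal \<Rightarrow> 'a::{comm_semiring_0,comm_monoid_mult}"
  assumes "finite V" "finite C" and "\<And>a::'a. a + a = a"
  shows "amc V {Disj (Abs_fset (f ` C))} \<alpha> = (\<Sum>c\<in>C. amc V {f c} \<alpha>)"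
  using assms
  by (simp add: amc_altdef Abs_fset_inverse sum.swap[of _ "interpretations V" C] sum_idempotent)

lemma vars_formula_of_literal: "vars (formula_of_literal l) \<subseteq> V \<longleftrightarrow> l \<in> literals V"
  by (cases l) simp_all

text \<open>Over the single variable of \<open>l\<close>, only one of the two interpretations is a
  model, and its weight is \<open>\<alpha> l\<close>.\<close>

lemma amc_literal:
  fixes \<alpha> :: "'v literal \<Rightarrow> 'a::{comm_semiring_0,comm_monoid_mult}"
  assumes "finite V" and "\<And>v. v \<in> V \<Longrightarrow> \<alpha> (Pos v) + \<alpha> (Neg v) = 1"
    and "l \<in> literals V"
  shows "amc V {formula_of_literal l} \<alpha> = \<alpha> l"
proof -
  obtain v where v: "l = Pos v \<or> l = Neg v" by (cases l) auto
  then have "v \<in> V" using assms(3) by auto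
  then have "amc V {formula_of_literal l} \<alpha> = amc {v} {formula_of_literal l} \<alpha>"
    using assms v by (intro amc_add_variables) auto
  also have "\<dots> = \<alpha> l"
    using v by (auto simp: amc_altdef interpretations_singleton)
  finally show ?thesis .
qed

section \<open>Evaluation of circuits\<close>

context nnf_circuit
begin

lemma children_in_nodes: "m \<in> children N n \<Longrightarrow> m \<in> nodes N"
  using edges_subset by (auto simp: children_def)

lemma vars_formula_of_node: "n \<in> nodes N \<Longrightarrow> vars (formula_of_node n) \<subseteq> V"
proof (induction n rule: formula_of_node.induct)
  case (1 n)
  show ?case
  proof (cases "label N n")
    case (Lit l)
    then show ?thesis
      using literals_over 1 by (simp add: formula_of_node.simps[of n] vars_formula_of_literal)
  next
    case And
    have "vars (formula_of_node m) \<subseteq> V" if "m \<in> children N n" for m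
      using 1 And that children_in_nodes by blast
    then show ?thesis
      using And by (auto simp: formula_of_node.simps[of n] Abs_fset_inverse finite_children)
  next
    case Or
    have "vars (formula_of_node m) \<subseteq> V" if "m \<in> children N n" for m
      using 1 Or that children_in_nodes by blast
    then show ?thesis
      using Or by (auto simp: formula_of_node.simps[of n] Abs_fset_inverse finite_children)
  qed (simp_all add: formula_of_node.simps[of n])
qed

text \<open>Every node is counted over the whole of \<open>V\<close> rather than over its own
  variables, so that the values of children combine directly. The induction runs along the edges,
  from children to parents.\<close>

lemma eval_node_eq_amc:
  fixes \<alpha> :: "'v literal \<Rightarrow> 'a::{comm_semiring_0,comm_monoid_mult}"
  assumes fin: "finite V" and idempotent: "\<And>a::'a. a + a = a"
    and neutral: "\<And>v. v \<in> V \<Longrightarrow> \<alpha> (Pos v) + \<alpha> (Neg v) = 1"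
    and dec: decomposable
  shows "n \<in> nodes N \<Longrightarrow> eval_node \<alpha> n = amc V {formula_of_node n} \<alpha>"
proof (induction n rule: formula_of_node.induct)
  case (1 n)
  note unfold = eval_node.simps[of \<alpha> n] formula_of_node.simps[of n]
  show ?case
  proof (cases "label N n")
    case Top
    \<comment> \<open>Both theories have all interpretations as models, and neutrality gives their
      total weight as one.\<close>
    have "amc V {Verum} \<alpha> = amc V {} \<alpha>" by (simp add: amc_def models_def)
    then show ?thesis using Top amc_empty_theory[of V \<alpha>] fin neutral by (simp add: unfold)
  next
    case Bot
    then show ?thesis by (simp add: unfold amc_def models_def)
  next
    case (Lit l)
    then show ?thesis
      using amc_literal[of V \<alpha> l] literals_over 1 fin neutral by (simp add: unfold)
  next
    case And
    have IH: "eval_node \<alpha> m = amc V {formula_of_node m} \<alpha>" if "m \<in> children N n" for m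
      using 1 And that children_in_nodes by blast
    have "amc V (formula_of_node ` children N n) \<alpha> =
        (\<Prod>m\<in>children N n. amc V {formula_of_node m} \<alpha>)"
    proof (rule amc_image_prod[OF fin neutral finite_children])
      show "vars (formula_of_node m) \<subseteq> V" if "m \<in> children N n" for m
        using that children_in_nodes vars_formula_of_node by blast
      show "vars (formula_of_node m) \<inter> vars (formula_of_node m') = {}"
        if "m \<in> children N n" "m' \<in> children N n" "m \<noteq> m'" for m m'
        using dec And 1(3) that unfolding decomposable_def by blast
    qed
    then show ?thesis using And IH by (simp add: unfold amc_Conj finite_children)
  next
    case Or
    have "eval_node \<alpha> m = amc V {formula_of_node m} \<alpha>" if "m \<in> children N n" for m
      using 1 Or that children_in_nodes by blast
    then show ?thesis
      using Or by (simp add: unfold amc_Disj fin idempotent finite_children)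
  qed
qed

end

theorem theorem5:
  fixes V :: "'v set"
    and T :: "'v formula set"
    and \<alpha> :: "'v literal \<Rightarrow> 'a::{comm_semiring_0,comm_monoid_mult}"
    and N :: "('n, 'v) circuit"
  assumes "finite V"
    and "theory_over V T"
    and idempotent: "\<And>a::'a. a + a = a"
    and neutral: "\<And>v. v \<in> V \<Longrightarrow> \<alpha> (Pos v) + \<alpha> (Neg v) = 1"
    and "dnnf_representation V N T"
  shows "nnf_circuit.eval N \<alpha> = amc V T \<alpha>"
proof -
  have circuit: "nnf_circuit V N" and dec: "nnf_circuit.decomposable N"
    and equiv: "models V {nnf_circuit.formula_of_node N (root N)} = models V T"
    using assms(5) by (simp_all add: dnnf_representation_def logically_equivalent_def)
  interpret nnf_circuit V N by (fact circuit)
  have "eval \<alpha> = amc V {formula_of_node (root N)} \<alpha>"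
    unfolding eval_def
    by (rule eval_node_eq_amc[OF assms(1) idempotent neutral dec root_in_nodes])
  \<comment> \<open>A count depends on its theory only through the set of models.\<close>
  also have "\<dots> = amc V T \<alpha>" by (simp add: amc_def equiv)
  finally show ?thesis .
qed

end
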